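(* Let $\mathbb{X}$ be a reflexive Banach space and $\mathbb{Y}$ any Banach space over the same field $\mathbb{K}\in\{\mathbb{R},\mathbb{C}\}$, and let $T:\mathbb{X}\to\mathbb{Y}$ be a bounded linear operator. If $x\in S_{\mathbb{X}}\setminus\ker T$ is a level vector of $T$, then there exists $\psi\in J\left(\frac{Tx}{\|Tx\|}\right)$ such that $\psi$ is a level vector of $T^{\times}$. Moreover, the level number of $T^{\times}$ corresponding to $\psi$ is equal to the level number of $T$ corresponding to $x$.
   Context: A semi-inner product on a normed space $\mathbb{X}$ over $\mathbb{K}$ is a function $[\cdot,\cdot]:\mathbb{X}\times\mathbb{X}\to\mathbb{K}$ such that for all $\alpha,\beta\in\mathbb{K}$, $x,y,z\in\mathbb{X}$: (1) $[\alpha x+\beta y,z]=\alpha[x,z]+\beta[y,z]$; (2) $[x,x]>0$ whenever $x\neq0$; (3) $|[x,y]|^2\le[x,x][y,y]$; (4) $[x,\alpha y]=\overline{\alpha}[x,y]$. All semi-inner products on a normed space are assumed compatible with the norm: $\|x\|=[x,x]^{1/2}$ for all $x$. For a bounded linear operator $T:\mathbb{X}\to\mathbb{Y}$, a nonzero $x\in\mathbb{X}$ is a level vector of $T$ if there exist a scalar $k$ (the level number of $T$ corresponding to $x$) and semi-inner products $[\cdot,\cdot]_{\mathbb{X}}$ on $\mathbb{X}$ and $[\cdot,\cdot]_{\mathbb{Y}}$ on $\mathbb{Y}$ with $[Ty,Tx]_{\mathbb{Y}}=k[y,x]_{\mathbb{X}}$ for all $y\in\mathbb{X}$. Necessarily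 $k=\|Tx\|^2/\|x\|^2$, so the level number corresponding to $x$ is unique. $S_{\mathbb{X}}$ is the unit sphere of $\mathbb{X}$. For nonzero $y\in\mathbb{Y}$, $J(y)=\{g\in\mathbb{Y}^*:\|g\|=1,\ g(y)=\|y\|\}$. $T^{\times}:\mathbb{Y}^*\to\mathbb{X}^*$ is the (Banach space) adjoint, $T^{\times}g=g\circ T$. *)

theory Defs
  imports "HOL-Analysis.Analysis"
begin

(* The scalar field, real or complex: a type of this class is, via to_complex, an isometric copy of
   one of the subfields \<real> and UNIV of the complex numbers. *)
class real_or_complex = real_normed_field +
  fixes to_complex :: "'a \<Rightarrow> complex"
    and scalar_cnj :: "'a \<Rightarrow> 'a"
  assumes to_complex_add: "to_complex (x + y) = to_complex x + to_complex y"
    and to_complex_mult: "to_complex (x * y) = to_complex x * to_complex y"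
    and to_complex_of_real: "to_complex (scaleR r 1) = complex_of_real r"
    and norm_to_complex: "norm (to_complex x) = norm x"
    and to_complex_scalar_cnj: "to_complex (scalar_cnj x) = cnj (to_complex x)"
    and range_to_complex: "range to_complex = \<real> \<or> range to_complex = UNIV"

instantiation real :: real_or_complex
begin

definition to_complex_real :: "real \<Rightarrow> complex" where "to_complex_real = complex_of_real"
definition scalar_cnj_real :: "real \<Rightarrow> real" where "scalar_cnj_real x = x"

instance
  by standard (auto simp: to_complex_real_def scalar_cnj_real_def Reals_def)

end

instantiation complex :: real_or_complex
begin

definition to_complex_complex :: "complex \<Rightarrow> complex" where "to_complex_complex z = z"
definition scalar_cnj_complex :: "complex \<Rightarrow> complex" where "scalar_cnj_complex = cnj"

instance
  by standard (auto simp: to_complex_complex_def scalar_cnj_complex_def scaleR_conv_of_real)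

end

definition scalar_Re :: "'k::real_or_complex \<Rightarrow> real" where
  "scalar_Re c = Re (to_complex c)"

locale normed_space_over = vector_space sc
  for sc :: "'k::real_or_complex \<Rightarrow> 'a::real_normed_vector \<Rightarrow> 'a" +
  assumes scale_of_real: "sc (of_real r) x = r *\<^sub>R x"
    and norm_scale: "norm (sc c x) = norm c * norm x"

lemma normed_space_over_real: "normed_space_over (scaleR :: real \<Rightarrow> 'a::real_normed_vector \<Rightarrow> 'a)"
  by unfold_locales (auto simp: algebra_simps)

lemma normed_space_over_complex: "normed_space_over ((*) :: complex \<Rightarrow> complex \<Rightarrow> complex)"
  by unfold_locales (auto simp: algebra_simps norm_mult scaleR_conv_of_real)

(* The type of bounded linear maps only knows real linearity, so over the complex numbers the dual
   is a proper subset of it. Hence the notions below are relative to a carrier set V. The norm of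
   the dual is the operator norm of this type. *)
definition dual_space :: "('k::real_or_complex \<Rightarrow> 'a::real_normed_vector \<Rightarrow> 'a) \<Rightarrow> ('a \<Rightarrow>\<^sub>L 'k) set" where
  "dual_space sc = {f. Vector_Spaces.linear sc (*) (blinfun_apply f)}"

definition dual_scale :: "'k::real_or_complex \<Rightarrow> ('a::real_normed_vector \<Rightarrow>\<^sub>L 'k) \<Rightarrow> ('a \<Rightarrow>\<^sub>L 'k)" where
  "dual_scale c f = blinfun_mult_right c o\<^sub>L f"

lemma dual_scale_apply [simp]: "blinfun_apply (dual_scale c f) x = c * blinfun_apply f x"
  by (simp add: dual_scale_def)

definition bidual_functional ::
  "('k::real_or_complex \<Rightarrow> 'a::real_normed_vector \<Rightarrow> 'a) \<Rightarrow> (('a \<Rightarrow>\<^sub>L 'k) \<Rightarrow> 'k) \<Rightarrow> bool" where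
  "bidual_functional sc \<phi> \<longleftrightarrow>
     (\<forall>f\<in>dual_space sc. \<forall>g\<in>dual_space sc. \<phi> (f + g) = \<phi> f + \<phi> g) \<and>
     (\<forall>c. \<forall>f\<in>dual_space sc. \<phi> (dual_scale c f) = c * \<phi> f) \<and>
     (\<exists>B. \<forall>f\<in>dual_space sc. norm (\<phi> f) \<le> B * norm f)"

(* surjectivity of the canonical embedding into the bidual *)
definition reflexive_space :: "('k::real_or_complex \<Rightarrow> 'a::real_normed_vector \<Rightarrow> 'a) \<Rightarrow> bool" where
  "reflexive_space sc \<longleftrightarrow>
     (\<forall>\<phi>. bidual_functional sc \<phi> \<longrightarrow> (\<exists>x. \<forall>f\<in>dual_space sc. \<phi> f = blinfun_apply f x))"

definition adjoint_op :: "('a::real_normed_vector \<Rightarrow>\<^sub>L 'b::real_normed_vector) \<Rightarrow>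
    ('b \<Rightarrow>\<^sub>L 'k::real_or_complex) \<Rightarrow> ('a \<Rightarrow>\<^sub>L 'k)" where
  "adjoint_op T g = g o\<^sub>L T"

definition support_functionals ::
  "('k::real_or_complex \<Rightarrow> 'a::real_normed_vector \<Rightarrow> 'a) \<Rightarrow> 'a \<Rightarrow> ('a \<Rightarrow>\<^sub>L 'k) set" where
  "support_functionals sc y =
     {g \<in> dual_space sc. norm g = 1 \<and> blinfun_apply g y = of_real (norm y)}"

(* The last clause is compatibility with the norm. *)
definition semi_inner_product ::
  "('k::real_or_complex \<Rightarrow> 'a::real_normed_vector \<Rightarrow> 'a) \<Rightarrow> 'a set \<Rightarrow> ('a \<Rightarrow> 'a \<Rightarrow> 'k) \<Rightarrow> bool" where
  "semi_inner_product sc V ip \<longleftrightarrow>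
     (\<forall>\<alpha> \<beta>. \<forall>x\<in>V. \<forall>y\<in>V. \<forall>z\<in>V.
        ip (sc \<alpha> x + sc \<beta> y) z = \<alpha> * ip x z + \<beta> * ip y z) \<and>
     (\<forall>x\<in>V. x \<noteq> 0 \<longrightarrow> ip x x \<in> \<real> \<and> scalar_Re (ip x x) > 0) \<and>
     (\<forall>x\<in>V. \<forall>y\<in>V. (norm (ip x y))\<^sup>2 \<le> scalar_Re (ip x x) * scalar_Re (ip y y)) \<and>
     (\<forall>\<alpha>. \<forall>x\<in>V. \<forall>y\<in>V. ip x (sc \<alpha> y) = scalar_cnj \<alpha> * ip x y) \<and>
     (\<forall>x\<in>V. norm x = sqrt (scalar_Re (ip x x)))"

definition is_level_number ::
  "('k::real_or_complex \<Rightarrow> 'a::real_normed_vector \<Rightarrow> 'a) \<Rightarrow> 'a set \<Rightarrow>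
   ('k \<Rightarrow> 'b::real_normed_vector \<Rightarrow> 'b) \<Rightarrow> 'b set \<Rightarrow> ('a \<Rightarrow> 'b) \<Rightarrow> 'a \<Rightarrow> 'k \<Rightarrow> bool" where
  "is_level_number sV V sW W T x k \<longleftrightarrow>
     (\<exists>ipV ipW. semi_inner_product sV V ipV \<and> semi_inner_product sW W ipW \<and>
        (\<forall>y\<in>V. ipW (T y) (T x) = k * ipV y x))"

definition level_vector ::
  "('k::real_or_complex \<Rightarrow> 'a::real_normed_vector \<Rightarrow> 'a) \<Rightarrow> 'a set \<Rightarrow>
   ('k \<Rightarrow> 'b::real_normed_vector \<Rightarrow> 'b) \<Rightarrow> 'b set \<Rightarrow> ('a \<Rightarrow> 'b) \<Rightarrow> 'a \<Rightarrow> bool" where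
  "level_vector sV V sW W T x \<longleftrightarrow> x \<in> V \<and> x \<noteq> 0 \<and> (\<exists>k. is_level_number sV V sW W T x k)"

(* well defined for level vectors by is_level_number_unique below *)
definition level_number ::
  "('k::real_or_complex \<Rightarrow> 'a::real_normed_vector \<Rightarrow> 'a) \<Rightarrow> 'a set \<Rightarrow>
   ('k \<Rightarrow> 'b::real_normed_vector \<Rightarrow> 'b) \<Rightarrow> 'b set \<Rightarrow> ('a \<Rightarrow> 'b) \<Rightarrow> 'a \<Rightarrow> 'k" where
  "level_number sV V sW W T x = (THE k. is_level_number sV V sW W T x k)"

lemma scalar_Re_of_real [simp]: "scalar_Re (of_real r :: 'k::real_or_complex) = r"
  by (simp add: scalar_Re_def of_real_def to_complex_of_real)

lemma semi_inner_product_self: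
  fixes sc :: "'k::real_or_complex \<Rightarrow> 'a::real_normed_vector \<Rightarrow> 'a"
  assumes ip: "semi_inner_product sc V ip" and x: "x \<in> V"
  shows "ip x x = of_real ((norm x)\<^sup>2)"
proof (cases "x = 0")
  case False
  with ip x have "ip x x \<in> \<real>" "scalar_Re (ip x x) > 0" and n: "norm x = sqrt (scalar_Re (ip x x))"
    unfolding semi_inner_product_def by blast+
  then obtain r where r: "ip x x = of_real r" by (auto simp: Reals_def)
  with \<open>scalar_Re (ip x x) > 0\<close> n have "r = (norm x)\<^sup>2" by simp
  with r show ?thesis by simp
next
  case True
  with ip x have "(norm (ip x x))\<^sup>2 \<le> scalar_Re (ip x x) * scalar_Re (ip x x)"
    "norm x = sqrt (scalar_Re (ip x x))"
    unfolding semi_inner_product_def by blast+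
  with True show ?thesis by simp
qed

lemma is_level_number_eq:
  assumes "is_level_number sV V sW W T x k" "x \<in> V" "x \<noteq> 0" "T x \<in> W"
  shows "k = of_real ((norm (T x))\<^sup>2 / (norm x)\<^sup>2)"
proof -
  obtain ipV ipW where ip: "semi_inner_product sV V ipV" "semi_inner_product sW W ipW"
    and eq: "ipW (T x) (T x) = k * ipV x x"
    using assms unfolding is_level_number_def by blast
  have "of_real ((norm (T x))\<^sup>2) = k * of_real ((norm x)\<^sup>2)"
    using eq semi_inner_product_self[OF ip(1) assms(2)] semi_inner_product_self[OF ip(2) assms(4)]
    by simp
  with assms(3) show ?thesis by (simp add: field_simps)
qed

lemma is_level_number_unique:
  assumes "level_vector sV V sW W T x" "T x \<in> W"
  shows "\<exists>!k. is_level_number sV V sW W T x k"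
  using assms is_level_number_eq[of sV V sW W T x] unfolding level_vector_def by metis

end

theory Submission
  imports Defs
begin

text \<open>
  Put \<open>\<psi> = [\<cdot>, Tx] / \<parallel>Tx\<parallel>\<close>. The level identity says that the adjoint sends \<open>\<psi>\<close> to
  \<open>\<parallel>Tx\<parallel> [\<cdot>, x]\<close>, so evaluation at \<open>Tx / \<parallel>Tx\<parallel>\<close> supports \<open>\<psi>\<close> and evaluation at \<open>\<parallel>Tx\<parallel> x\<close> supports
  its image; these two evaluations intertwine with constant \<open>\<parallel>Tx\<parallel>\<^sup>2\<close>. It remains to complete each
  of them to a semi-inner product on the dual, which amounts to one support functional for every
  line. In a dual space these exist without the Hahn--Banach theorem: take a cluster point, for
  pointwise convergence, of the evaluations at an almost norming sequence of unit vectors.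
\<close>

subsection \<open>The scalar field\<close>

lemma to_complex_minus: "to_complex (x - y :: 'k::real_or_complex) = to_complex x - to_complex y"
  using to_complex_add[of "x - y" y] by simp

lemma dist_to_complex: "dist (to_complex x) (to_complex (y :: 'k::real_or_complex)) = dist x y"
  by (simp add: dist_norm norm_to_complex flip: to_complex_minus)

lemma to_complex_eq_iff: "to_complex x = to_complex y \<longleftrightarrow> x = (y :: 'k::real_or_complex)"
  by (metis dist_eq_0_iff dist_to_complex)

lemma to_complex_eqI: "to_complex x = to_complex y \<Longrightarrow> x = (y :: 'k::real_or_complex)"
  by (simp add: to_complex_eq_iff)

lemma to_complex_of_real': "to_complex (of_real r :: 'k::real_or_complex) = of_real r"
  by (simp add: of_real_def to_complex_of_real)

lemma scalar_cnj_mult: "scalar_cnj (a * b :: 'k::real_or_complex) = scalar_cnj a * scalar_cnj b"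
  by (rule to_complex_eqI) (simp add: to_complex_scalar_cnj to_complex_mult)

lemma scalar_cnj_0 [simp]: "scalar_cnj (0 :: 'k::real_or_complex) = 0"
  using norm_to_complex[of "0 :: 'k"] norm_to_complex[of "scalar_cnj (0 :: 'k)"]
  by (simp add: to_complex_scalar_cnj)

lemma scalar_cnj_1 [simp]: "scalar_cnj (1 :: 'k::real_or_complex) = 1"
  by (rule to_complex_eqI) (use to_complex_of_real'[of 1, where 'k = 'k] in \<open>simp add: to_complex_scalar_cnj\<close>)

lemma norm_scalar_cnj [simp]: "norm (scalar_cnj (a :: 'k::real_or_complex)) = norm a"
  by (metis complex_mod_cnj norm_to_complex to_complex_scalar_cnj)

lemma scalar_cnj_mult_self: "scalar_cnj a * a = of_real ((norm (a :: 'k::real_or_complex))\<^sup>2)"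
proof -
  have "cnj (to_complex a) * to_complex a = of_real ((norm a)\<^sup>2)"
    by (metis complex_norm_square mult.commute norm_to_complex of_real_power)
  then have "to_complex (scalar_cnj a * a) = to_complex (of_real ((norm a)\<^sup>2))"
    by (simp only: to_complex_scalar_cnj to_complex_mult to_complex_of_real')
  then show ?thesis
    by (rule to_complex_eqI)
qed

text \<open>The class does not assume compactness of balls. It is transported from the complex
  plane: \<open>to_complex\<close> is isometric onto its range, which is closed in either of the two
  cases.\<close>

lemma compact_cball_scalar: "compact (cball (0 :: 'k::real_or_complex) r)"
proof -
  let ?R = "range (to_complex :: 'k \<Rightarrow> complex)"
  let ?i = "inv (to_complex :: 'k \<Rightarrow> complex)"
  have inv: "?i (to_complex z) = z" for z :: 'k
    by (rule inv_f_f) (simp add: inj_def to_complex_eq_iff)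
  have "closed ?R"
    using range_to_complex[where 'a = 'k] closed_complex_Reals by auto
  then have "compact (cball 0 r \<inter> ?R)"
    by (rule compact_Int_closed[OF compact_cball])
  moreover have "continuous_on (cball 0 r \<inter> ?R) ?i"
  proof (rule continuous_on_subset)
    show "continuous_on ?R ?i"
      unfolding continuous_on_iff using inv dist_to_complex by (metis (no_types) imageE)
  qed auto
  moreover have "?i ` (cball 0 r \<inter> ?R) = cball 0 r"
    by (force simp: inv norm_to_complex image_iff)
  ultimately show ?thesis
    by (metis compact_continuous_image)
qed

subsection \<open>Semi-inner products from support forms\<close>

text \<open>Abstracts the section \<open>ip _ v\<close> of a norm-compatible semi-inner product:
  \<open>norm v\<close> times a norm-one support functional at \<open>v\<close>, for nonzero
  \<open>v\<close>. A plain function is used because the linearity and the bound concern only the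
  carrier \<open>V\<close>.\<close>

definition support_form ::
  "('k::real_or_complex \<Rightarrow> 'a::real_normed_vector \<Rightarrow> 'a) \<Rightarrow> 'a set \<Rightarrow> 'a \<Rightarrow> ('a \<Rightarrow> 'k) \<Rightarrow> bool" where
  "support_form sc V v \<Psi> \<longleftrightarrow>
     (\<forall>\<alpha> \<beta>. \<forall>x\<in>V. \<forall>y\<in>V. \<Psi> (sc \<alpha> x + sc \<beta> y) = \<alpha> * \<Psi> x + \<beta> * \<Psi> y) \<and>
     (\<forall>x\<in>V. norm (\<Psi> x) \<le> norm v * norm x) \<and>
     \<Psi> v = of_real ((norm v)\<^sup>2)"

context normed_space_over
begin

text \<open>At the new base point linearity produces a factor \<open>c\<close>, and its product with
  \<open>scalar_cnj c\<close> is the required \<open>(norm c)\<^sup>2\<close>.\<close>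

lemma support_form_scale:
  assumes "support_form sc V v \<Psi>" "v \<in> V"
  shows "support_form sc V (sc c v) (\<lambda>x. scalar_cnj c * \<Psi> x)"
proof -
  have "\<Psi> (sc c v + sc 0 v) = c * \<Psi> v + 0 * \<Psi> v"
    using assms unfolding support_form_def by blast
  then have "\<Psi> (sc c v) = c * of_real ((norm v)\<^sup>2)"
    using assms by (simp add: support_form_def)
  then have "scalar_cnj c * \<Psi> (sc c v) = of_real ((norm (sc c v))\<^sup>2)"
    by (simp add: scalar_cnj_mult_self norm_scale power_mult_distrib flip: mult.assoc)
  moreover have "norm (scalar_cnj c * \<Psi> x) \<le> norm (sc c v) * norm x" if "x \<in> V" for x
    using assms that mult_left_mono[of "norm (\<Psi> x)" "norm v * norm x" "norm c"]
    by (simp add: support_form_def norm_mult norm_scale mult.assoc)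
  ultimately show ?thesis
    using assms by (simp add: support_form_def algebra_simps)
qed

text \<open>The norm bound of a support form, squared, is the Cauchy-Schwarz clause. The value 0 at
  \<open>v = 0\<close> is forced by compatibility with the norm.\<close>

lemma semi_inner_product_of_support_forms:
  assumes supp: "\<And>v. v \<in> V \<Longrightarrow> v \<noteq> 0 \<Longrightarrow> support_form sc V v (\<Psi> v)"
    and hom: "\<And>c v x. v \<in> V \<Longrightarrow> v \<noteq> 0 \<Longrightarrow> c \<noteq> 0 \<Longrightarrow> \<Psi> (sc c v) x = scalar_cnj c * \<Psi> v x"
  shows "semi_inner_product sc V (\<lambda>x v. if v = 0 then 0 else \<Psi> v x)" (is "semi_inner_product sc V ?ip")
proof -
  have lin: "?ip (sc \<alpha> x + sc \<beta> y) z = \<alpha> * ?ip x z + \<beta> * ?ip y z"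
    if "x \<in> V" "y \<in> V" "z \<in> V" for \<alpha> \<beta> x y z
    using supp[of z] that by (simp add: support_form_def)
  have self: "?ip x x = of_real ((norm x)\<^sup>2)" if "x \<in> V" for x
    using supp[of x] that by (simp add: support_form_def)
  have cs: "(norm (?ip x y))\<^sup>2 \<le> scalar_Re (?ip x x) * scalar_Re (?ip y y)"
    if "x \<in> V" "y \<in> V" for x y
  proof -
    have "norm (?ip x y) \<le> norm y * norm x"
      using supp[of y] that by (simp add: support_form_def)
    then have "(norm (?ip x y))\<^sup>2 \<le> (norm y * norm x)\<^sup>2"
      by (rule power_mono) simp
    also have "\<dots> = scalar_Re (?ip x x) * scalar_Re (?ip y y)"
      unfolding self[OF that(1)] self[OF that(2)] scalar_Re_of_real
      by (simp add: power_mult_distrib mult.commute)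
    finally show ?thesis .
  qed
  have conj: "?ip x (sc \<alpha> y) = scalar_cnj \<alpha> * ?ip x y" if "x \<in> V" "y \<in> V" for \<alpha> x y
    using hom[of y \<alpha> x] that by (cases "\<alpha> = 0"; cases "y = 0") auto
  show ?thesis
    unfolding semi_inner_product_def
  proof (intro conjI allI ballI impI)
    fix x assume "x \<in> V"
    note s = self[OF this]
    show "norm x = sqrt (scalar_Re (?ip x x))"
      unfolding s scalar_Re_of_real by simp
    assume "x \<noteq> 0"
    then show "scalar_Re (?ip x x) > 0" "?ip x x \<in> \<real>"
      unfolding s scalar_Re_of_real by auto
  qed (use lin cs conj in blast)+
qed

text \<open>Conjugate homogeneity ties the support forms along a line together, so they are chosen at one
  representative per line, which is \<open>v\<^sub>0\<close> for the line through \<open>v\<^sub>0\<close>.\<close>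

lemma semi_inner_product_extending:
  assumes scaled: "\<And>c v. v \<in> V \<Longrightarrow> sc c v \<in> V"
    and supp: "\<And>v. v \<in> V \<Longrightarrow> v \<noteq> 0 \<Longrightarrow> \<exists>\<Psi>. support_form sc V v \<Psi>"
    and v0: "v\<^sub>0 \<in> V" "v\<^sub>0 \<noteq> 0" and \<Psi>0: "support_form sc V v\<^sub>0 \<Psi>\<^sub>0"
  shows "\<exists>ip. semi_inner_product sc V ip \<and> (\<forall>x. ip x v\<^sub>0 = \<Psi>\<^sub>0 x)"
proof -
  \<comment> \<open>For nonzero \<open>v\<close> this is the line through \<open>v\<close> without
    the origin. A chosen point of it depends on the set alone, so proportional vectors share their
    representative.\<close>
  define line where "line v = {u. \<exists>c. c \<noteq> 0 \<and> v = sc c u}" for v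
  define rep where "rep v = (if v\<^sub>0 \<in> line v then v\<^sub>0 else SOME u. u \<in> line v)" for v
  define coef where "coef v = (SOME c. c \<noteq> 0 \<and> v = sc c (rep v))" for v
  define S where "S u = (if u = v\<^sub>0 then \<Psi>\<^sub>0 else SOME \<Psi>. support_form sc V u \<Psi>)" for u
  define \<Psi> where "\<Psi> v x = scalar_cnj (coef v) * S (rep v) x" for v x
  have S: "support_form sc V u (S u)" if "u \<in> V" "u \<noteq> 0" for u
    using someI_ex[OF supp[OF that]] \<Psi>0 by (simp add: S_def)
  have self_line: "v \<in> line v" for v
    by (auto simp: line_def intro!: exI[of _ 1])
  then have rep_line: "rep v \<in> line v" for v
    unfolding rep_def by (metis someI)
  then have "\<exists>c. c \<noteq> 0 \<and> v = sc c (rep v)" for v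
    unfolding line_def by blast
  then have coef: "coef v \<noteq> 0 \<and> v = sc (coef v) (rep v)" for v
    unfolding coef_def by (rule someI_ex)
  have rep_inverse: "rep v = sc (inverse (coef v)) v" for v
    using coef[of v] by (metis scale_scale left_inverse scale_one)
  have rep_V: "rep v \<in> V" if "v \<in> V" for v
    unfolding rep_inverse using that by (rule scaled)
  have rep_nonzero: "rep v \<noteq> 0" if "v \<noteq> 0" for v
    using coef[of v] that by (metis scale_zero_right)
  have line_scale: "line (sc c v) = line v" if "c \<noteq> 0" for c v
  proof -
    have "sc c v = sc (c * d) u \<longleftrightarrow> v = sc d u" for d u
      using that by (metis scale_scale scale_cancel_left)
    \<comment> \<open>Every coefficient for \<open>sc c v\<close> is \<open>c\<close> times one for
      \<open>v\<close>, so both vectors have the same \<open>line\<close>.\<close>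
    moreover have "\<exists>d'. d = c * d'" for d
      using that by (intro exI[of _ "d / c"]) simp
    ultimately show ?thesis
      using that unfolding line_def by (metis mult_eq_0_iff)
  qed
  have rep_scale: "rep (sc c v) = rep v" if "c \<noteq> 0" for c v
    by (simp add: rep_def line_scale[OF that])
  \<comment> \<open>Both coefficients express \<open>sc c v\<close> through the same nonzero
    representative, which can be cancelled.\<close>
  have coef_scale: "coef (sc c v) = c * coef v" if "c \<noteq> 0" "v \<noteq> 0" for c v
    using coef[of "sc c v"] coef[of v] rep_nonzero[OF that(2)]
    by (metis rep_scale[OF that(1)] scale_scale scale_right_imp_eq)
  have rep_v0: "rep v\<^sub>0 = v\<^sub>0"
    using self_line by (simp add: rep_def)
  then have coef_v0: "coef v\<^sub>0 = 1"
    using coef[of v\<^sub>0] v0(2) by (metis scale_one scale_right_imp_eq)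
  have "semi_inner_product sc V (\<lambda>x v. if v = 0 then 0 else \<Psi> v x)"
  proof (rule semi_inner_product_of_support_forms)
    show "support_form sc V v (\<Psi> v)" if "v \<in> V" "v \<noteq> 0" for v
      using support_form_scale[OF S[OF rep_V rep_nonzero] rep_V, OF that that(1), of "coef v"]
        coef[of v] unfolding \<Psi>_def by simp
    show "\<Psi> (sc c v) x = scalar_cnj c * \<Psi> v x" if "v \<in> V" "v \<noteq> 0" "c \<noteq> 0" for c v x
      using that by (simp add: \<Psi>_def rep_scale coef_scale scalar_cnj_mult mult.assoc)
  qed
  moreover have "\<Psi> v\<^sub>0 x = \<Psi>\<^sub>0 x" for x
    by (simp add: \<Psi>_def rep_v0 coef_v0 S_def)
  ultimately show ?thesis
    using v0(2) by (intro exI[of _ "\<lambda>x v. if v = 0 then 0 else \<Psi> v x"]) simp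
qed

end

section \<open>Sections of a semi-inner product as bounded linear functionals\<close>

lemma semi_inner_product_norm_le:
  assumes "semi_inner_product sc V ip" "x \<in> V" "y \<in> V"
  shows "norm (ip x y) \<le> norm x * norm y"
proof (rule power2_le_imp_le)
  have "(norm (ip x y))\<^sup>2 \<le> scalar_Re (ip x x) * scalar_Re (ip y y)"
    using assms unfolding semi_inner_product_def by blast
  then show "(norm (ip x y))\<^sup>2 \<le> (norm x * norm y)\<^sup>2"
    by (simp only: semi_inner_product_self[OF assms(1,2)] semi_inner_product_self[OF assms(1,3)]
        scalar_Re_of_real power_mult_distrib)
qed simp

lemma semi_inner_product_linear:
  assumes "semi_inner_product sc UNIV ip" "normed_space_over sc"
  shows "Vector_Spaces.linear sc (*) (\<lambda>x. ip x z)"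
proof -
  interpret normed_space_over sc by fact
  interpret k: vector_space "(*) :: 'a \<Rightarrow> 'a \<Rightarrow> 'a"
    by unfold_locales (auto simp: algebra_simps)
  have lin: "ip (sc \<alpha> x + sc \<beta> y) z = \<alpha> * ip x z + \<beta> * ip y z" for \<alpha> \<beta> x y
    using assms(1) by (simp add: semi_inner_product_def)
  show ?thesis
  proof unfold_locales
    show "ip (x + y) z = ip x z + ip y z" for x y
      using lin[of 1 x 1 y] by simp
    show "ip (sc c x) z = c * ip x z" for c x
      using lin[of c x 0 x] by simp
  qed
qed

lemma semi_inner_product_bounded_linear:
  assumes ip: "semi_inner_product sc UNIV ip" and "normed_space_over sc"
  shows "bounded_linear (\<lambda>x. ip x z)"
proof -
  interpret normed_space_over sc by fact
  interpret l: Vector_Spaces.linear sc "(*)" "\<lambda>x. ip x z"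
    using assms by (rule semi_inner_product_linear)
  show ?thesis
  proof (rule bounded_linear_intro)
    show "ip (r *\<^sub>R x) z = r *\<^sub>R ip x z" for r x
      using l.scale[of "of_real r" x] by (simp add: scale_of_real scaleR_conv_of_real)
  qed (use l.add semi_inner_product_norm_le[OF ip] in auto)
qed

subsection \<open>Dual spaces\<close>

lemma dual_scale_closed: "f \<in> dual_space sc \<Longrightarrow> dual_scale c f \<in> dual_space sc"
  by (auto simp: dual_space_def Vector_Spaces.linear_iff algebra_simps)

text \<open>The operator norm directly gives one inequality for \<open>norm_scale\<close>; applying
  it to \<open>inverse c\<close> gives the other.\<close>

lemma normed_space_over_dual:
  "normed_space_over (dual_scale :: 'k::real_or_complex \<Rightarrow> ('a::real_normed_vector \<Rightarrow>\<^sub>L 'k) \<Rightarrow> _)"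
proof
  fix c :: 'k and f :: "'a \<Rightarrow>\<^sub>L 'k"
  have le: "norm (dual_scale a g) \<le> norm a * norm g" for a :: 'k and g :: "'a \<Rightarrow>\<^sub>L 'k"
    using norm_blinfun[of g]
    by (intro norm_blinfun_bound) (auto simp: norm_mult mult.assoc intro: mult_left_mono)
  show "norm (dual_scale c f) = norm c * norm f"
  proof (cases "c = 0")
    case False
    have "dual_scale (inverse c) (dual_scale c f) = f"
      using False by (intro blinfun_eqI) simp
    then have "norm f \<le> norm (inverse c) * norm (dual_scale c f)"
      using le[of "inverse c" "dual_scale c f"] by simp
    then have "norm c * norm f \<le> norm (dual_scale c f)"
      unfolding norm_inverse using False by (simp add: field_simps)
    with le[of c f] show ?thesis by simp
  qed (use le[of c f] in simp)
qed (auto intro!: blinfun_eqI simp: blinfun.bilinear_simps algebra_simps scaleR_conv_of_real)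

text \<open>A Banach-Alaoglu argument. Evaluations respect \<open>dual_scale\<close> on all bounded
  real-linear maps, so the limit is built on the whole type and covers its subset
  \<open>dual_space\<close>.\<close>

lemma dual_support_functional:
  fixes f :: "'a::real_normed_vector \<Rightarrow>\<^sub>L 'k::real_or_complex"
  assumes "f \<noteq> 0"
  obtains \<Phi> where "\<And>g h. \<Phi> (g + h) = \<Phi> g + \<Phi> h" "\<And>c g. \<Phi> (dual_scale c g) = c * \<Phi> g"
    "\<And>g. norm (\<Phi> g) \<le> norm g" "norm (\<Phi> f) = norm f"
proof -
  \<comment> \<open>Otherwise \<open>norm f - b\<close>, nonnegative by
    \<open>b \<le> norm f\<close>, would bound the operator norm. Below \<open>b\<close> is
    \<open>norm f / Suc n\<close>.\<close>
  have "\<exists>y. norm (blinfun_apply f y) > (norm f - b) * norm y" if "0 < b" "b \<le> norm f" for b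
  proof (rule ccontr)
    assume "\<not> ?thesis"
    then have "norm f \<le> norm f - b"
      using that by (intro norm_blinfun_bound) (auto simp: not_less)
    with that show False by simp
  qed
  then have "\<exists>y. norm (blinfun_apply f y) > (norm f - norm f / real (Suc n)) * norm y" for n
    using assms by (simp add: divide_le_eq)
  then obtain y where
    y: "\<And>n. norm (blinfun_apply f (y n)) > (norm f - norm f / real (Suc n)) * norm (y n)"
    by metis
  have y0: "y n \<noteq> 0" for n
    using y[of n] by auto
  define e where "e n g = blinfun_apply g (y n) / of_real (norm (y n))" for n and g :: "'a \<Rightarrow>\<^sub>L 'k"
  have e_le: "norm (e n g) \<le> norm g" for n g
    using norm_blinfun[of g "y n"] y0[of n] by (simp add: e_def norm_divide divide_le_eq)
  have lower: "norm (e n f) \<ge> norm f - norm f / real (Suc n)" for n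
    using y[of n] y0[of n] by (simp add: e_def norm_divide le_divide_eq)
  have "(\<lambda>n. norm f - norm f / real (Suc n)) \<longlonglongrightarrow> norm f - 0"
    by (intro tendsto_intros filterlim_compose[OF lim_const_over_n filterlim_Suc])
  then have lower_lim: "(\<lambda>n. norm f - norm f / real (Suc n)) \<longlonglongrightarrow> norm f"
    by simp
  have e_f: "(\<lambda>n. norm (e n f)) \<longlonglongrightarrow> norm f"
    by (rule real_tendsto_sandwich[OF always_eventually always_eventually lower_lim tendsto_const])
      (use lower e_le in auto)
  \<comment> \<open>All \<open>e n\<close> lie in this product of closed balls, which is compact for
    pointwise convergence by Tychonoff.\<close>
  define K where "K = (\<Pi>\<^sub>E g\<in>(UNIV :: ('a \<Rightarrow>\<^sub>L 'k) set). cball (0 :: 'k) (norm g))"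
  have "compactin (product_topology (\<lambda>_. euclidean) UNIV) K"
    unfolding K_def compactin_PiE by (simp add: compact_cball_scalar)
  then have "compact K"
    by (simp add: euclidean_product_topology)
  moreover have "eventually (\<lambda>u. u \<in> K) (filtermap e sequentially)"
    using e_le by (simp add: eventually_filtermap K_def PiE_iff)
  ultimately obtain \<Phi> where \<Phi>: "\<Phi> \<in> K" "inf (nhds \<Phi>) (filtermap e sequentially) \<noteq> bot"
    unfolding compact_filter by (metis filtermap_bot_iff sequentially_bot)
  \<comment> \<open>A proper filter that refines the sequence \<open>e\<close> and converges to the
    cluster point; it stands in for a convergent subsequence, which may fail to exist.\<close>
  define F where "F = inf (nhds \<Phi>) (filtermap e sequentially)"
  have F: "F \<noteq> bot" "F \<le> nhds \<Phi>" "F \<le> filtermap e sequentially"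
    using \<Phi> by (auto simp: F_def)
  have lim: "((\<lambda>u. u g) \<longlongrightarrow> \<Phi> g) F" for g
  proof (rule tendsto_mono[OF F(2)])
    \<comment> \<open>Continuity of the coordinate gives the punctured limit; the limit value is
      also the value at the point itself, so it holds along \<open>nhds\<close> too.\<close>
    have "((\<lambda>u. u g) \<longlongrightarrow> \<Phi> g) (at \<Phi>)"
      using continuous_on_product_coordinates[of g, where 'b = 'k] by (simp add: continuous_on_def)
    then show "((\<lambda>u. u g) \<longlongrightarrow> \<Phi> g) (nhds \<Phi>)"
      by (simp add: tendsto_at_iff_tendsto_nhds[of "\<lambda>u. u g"])
  qed
  \<comment> \<open>Whatever holds for every evaluation \<open>e n\<close> thus passes to the limit
    along \<open>F\<close>.\<close>
  have ev: "eventually P F" if "\<And>n. P (e n)" for P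
    using F(3) that by (auto simp: le_filter_def eventually_filtermap)
  show ?thesis
  proof
    show "\<Phi> (g + h) = \<Phi> g + \<Phi> h" for g h
    proof (rule tendsto_unique[OF F(1) lim])
      show "((\<lambda>u. u (g + h)) \<longlongrightarrow> \<Phi> g + \<Phi> h) F"
        by (rule Lim_transform_eventually[OF tendsto_add[OF lim lim]])
          (rule ev, simp add: e_def blinfun.add_left add_divide_distrib)
    qed
    show "\<Phi> (dual_scale c g) = c * \<Phi> g" for c g
    proof (rule tendsto_unique[OF F(1) lim])
      show "((\<lambda>u. u (dual_scale c g)) \<longlongrightarrow> c * \<Phi> g) F"
        by (rule Lim_transform_eventually[OF tendsto_mult_left[OF lim]])
          (rule ev, simp add: e_def)
    qed
    show "norm (\<Phi> g) \<le> norm g" for g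
      using \<Phi>(1) by (auto simp: K_def PiE_iff)
    show "norm (\<Phi> f) = norm f"
    proof (rule tendsto_unique[OF F(1)])
      show "((\<lambda>u. norm (u f)) \<longlongrightarrow> norm (\<Phi> f)) F"
        by (intro tendsto_norm lim)
      have "((\<lambda>u. norm (u f)) \<longlongrightarrow> norm f) (filtermap e sequentially)"
        using e_f by (simp add: filterlim_filtermap)
      then show "((\<lambda>u. norm (u f)) \<longlongrightarrow> norm f) F"
        by (rule tendsto_mono[OF F(3)])
    qed
  qed
qed

lemma dual_support_form_exists:
  fixes f :: "'a::real_normed_vector \<Rightarrow>\<^sub>L 'k::real_or_complex"
  assumes "f \<noteq> 0"
  shows "\<exists>\<Psi>. support_form dual_scale V f \<Psi>"
proof -
  obtain \<Phi> where \<Phi>: "\<And>g h. \<Phi> (g + h) = \<Phi> g + \<Phi> h" "\<And>c g. \<Phi> (dual_scale c g) = c * \<Phi> g"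
    "\<And>g. norm (\<Phi> g) \<le> norm g" "norm (\<Phi> f) = norm f"
    using dual_support_functional[OF assms] by blast
  have f: "\<Phi> f \<noteq> 0"
    using \<Phi>(4) assms by auto
  \<comment> \<open>Corrects the phase of \<open>\<Phi> f\<close> and scales its modulus from
    \<open>norm f\<close> to \<open>(norm f)\<^sup>2\<close>.\<close>
  let ?c = "of_real ((norm f)\<^sup>2) / \<Phi> f"
  have "norm ?c = norm f"
    using assms by (simp add: norm_divide \<Phi>(4) power2_eq_square norm_mult)
  then have "norm (?c * \<Phi> g) \<le> norm f * norm g" for g
    by (simp only: norm_mult mult_left_mono[OF \<Phi>(3)] norm_ge_zero)
  moreover have "?c * \<Phi> (dual_scale \<alpha> g + dual_scale \<beta> h) = \<alpha> * (?c * \<Phi> g) + \<beta> * (?c * \<Phi> h)"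
    for \<alpha> \<beta> g h
    by (simp add: \<Phi>(1,2) algebra_simps add_divide_distrib)
  ultimately have "support_form dual_scale V f (\<lambda>g. ?c * \<Phi> g)"
    unfolding support_form_def using f by auto
  then show ?thesis by blast
qed

lemma support_form_evaluation:
  fixes f :: "'a::real_normed_vector \<Rightarrow>\<^sub>L 'k::real_or_complex"
  assumes "norm z \<le> norm f" "blinfun_apply f z = of_real ((norm f)\<^sup>2)"
  shows "support_form dual_scale V f (\<lambda>g. blinfun_apply g z)"
proof -
  have "norm (blinfun_apply g z) \<le> norm f * norm g" for g :: "'a \<Rightarrow>\<^sub>L 'k"
    using norm_blinfun[of g z] mult_left_mono[OF assms(1), of "norm g"] by (simp add: mult.commute)
  then show ?thesis
    using assms(2) by (simp add: support_form_def blinfun.add_left)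
qed

text \<open>The section at one functional \<open>f\<close> is prescribed as evaluation at a point of
  the space; the other lines of the dual receive support forms from the compactness
  argument.\<close>

lemma dual_semi_inner_product_evaluation:
  fixes f :: "'a::real_normed_vector \<Rightarrow>\<^sub>L 'k::real_or_complex"
  assumes "f \<in> dual_space sc" "f \<noteq> 0" "norm z \<le> norm f" "blinfun_apply f z = of_real ((norm f)\<^sup>2)"
  obtains ip where "semi_inner_product dual_scale (dual_space sc) ip" "\<And>g. ip g f = blinfun_apply g z"
proof -
  interpret normed_space_over "dual_scale :: 'k \<Rightarrow> ('a \<Rightarrow>\<^sub>L 'k) \<Rightarrow> _"
    by (rule normed_space_over_dual)
  show ?thesis
    using semi_inner_product_extending[OF dual_scale_closed dual_support_form_exists assms(1,2)
        support_form_evaluation[OF assms(3,4)]] that by blast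
qed

section \<open>Passing a level vector to the adjoint\<close>

theorem theorem2p18:
  fixes sX :: "'k::real_or_complex \<Rightarrow> 'a::banach \<Rightarrow> 'a"
    and sY :: "'k \<Rightarrow> 'b::banach \<Rightarrow> 'b"
    and T :: "'a \<Rightarrow>\<^sub>L 'b"
    and x :: 'a
  assumes "normed_space_over sX" and "normed_space_over sY"
    and "reflexive_space sX"
    and "Vector_Spaces.linear sX sY (blinfun_apply T)"
    and "norm x = 1" and "blinfun_apply T x \<noteq> 0"
    and "level_vector sX UNIV sY UNIV (blinfun_apply T) x"
  shows "\<exists>\<psi> \<in> support_functionals sY (blinfun_apply T x /\<^sub>R norm (blinfun_apply T x)).
           level_vector dual_scale (dual_space sY) dual_scale (dual_space sX) (adjoint_op T) \<psi> \<and>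
           level_number dual_scale (dual_space sY) dual_scale (dual_space sX) (adjoint_op T) \<psi> =
           level_number sX UNIV sY UNIV (blinfun_apply T) x"
proof -
  define r where "r = norm (blinfun_apply T x)"
  \<comment> \<open>The quotient of squared norms in \<open>is_level_number_eq\<close>, as
    \<open>norm x = 1\<close>.\<close>
  define k :: 'k where "k = of_real (r\<^sup>2)"
  have r: "r > 0"
    using assms(6) by (simp add: r_def)
  obtain k0 where "is_level_number sX UNIV sY UNIV (blinfun_apply T) x k0"
    using assms(7) by (auto simp: level_vector_def)
  moreover have "k0 = k"
    using is_level_number_eq[OF calculation] assms(5) by (fastforce simp: k_def r_def)
  ultimately have lk: "is_level_number sX UNIV sY UNIV (blinfun_apply T) x k"
    by simp
  then obtain ipX ipY where ipX: "semi_inner_product sX UNIV ipX"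
    and ipY: "semi_inner_product sY UNIV ipY"
    and eq: "\<And>y. ipY (blinfun_apply T y) (blinfun_apply T x) = k * ipX y x"
    by (auto simp: is_level_number_def)
  have ipY_bl: "bounded_linear (\<lambda>w. ipY w (blinfun_apply T x))"
    using ipY assms(2) by (rule semi_inner_product_bounded_linear)
  define \<psi> where "\<psi> = dual_scale (of_real (1 / r)) (Blinfun (\<lambda>w. ipY w (blinfun_apply T x)))"
  have \<psi>: "blinfun_apply \<psi> w = of_real (1 / r) * ipY w (blinfun_apply T x)" for w
    by (simp add: \<psi>_def bounded_linear_Blinfun_apply[OF ipY_bl])
  have \<psi>_dual: "\<psi> \<in> dual_space sY"
    unfolding \<psi>_def
    by (rule dual_scale_closed)
      (simp add: dual_space_def bounded_linear_Blinfun_apply[OF ipY_bl]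
        semi_inner_product_linear[OF ipY assms(2)])
  have \<psi>_Tx: "blinfun_apply \<psi> (blinfun_apply T x) = of_real r"
    using r semi_inner_product_self[OF ipY, of "blinfun_apply T x"]
    by (simp add: \<psi> r_def power2_eq_square flip: of_real_mult of_real_divide)
  have "norm \<psi> \<le> 1"
  proof (rule norm_blinfun_bound)
    show "norm (blinfun_apply \<psi> w) \<le> 1 * norm w" for w
      using semi_inner_product_norm_le[OF ipY, of w "blinfun_apply T x"] r
      by (simp add: \<psi> norm_mult norm_divide divide_le_eq r_def)
  qed simp
  \<comment> \<open>The norm is attained at \<open>T x\<close>, where \<open>\<psi>\<close> has the
    value \<open>r = norm (T x)\<close>.\<close>
  moreover have "norm \<psi> \<ge> 1"
    using norm_blinfun[of \<psi> "blinfun_apply T x"] r by (simp add: \<psi>_Tx flip: r_def)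
  ultimately have norm_\<psi>: "norm \<psi> = 1" by simp
  have \<psi>_unit: "blinfun_apply \<psi> (blinfun_apply T x /\<^sub>R r) = 1"
    using r by (simp add: blinfun.scaleR_right \<psi>_Tx scaleR_conv_of_real)
  have supp: "\<psi> \<in> support_functionals sY (blinfun_apply T x /\<^sub>R norm (blinfun_apply T x))"
    using \<psi>_dual norm_\<psi> \<psi>_unit r by (simp add: support_functionals_def flip: r_def)

  define \<theta> where "\<theta> = adjoint_op T \<psi>"
  \<comment> \<open>By the level identity the factor is
    \<open>(1 / r) * r\<^sup>2 = r\<close>.\<close>
  have \<theta>: "blinfun_apply \<theta> y = of_real r * ipX y x" for y
    using r by (simp add: \<theta>_def adjoint_op_def \<psi> eq k_def power2_eq_square)
  have \<theta>_dual: "\<theta> \<in> dual_space sX"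
    using Vector_Spaces.linear_compose[of sX sY "blinfun_apply T" "(*)" "blinfun_apply \<psi>"]
      assms(4) \<psi>_dual by (simp add: dual_space_def \<theta>_def adjoint_op_def blinfun_compose.rep_eq)
  have \<theta>_x: "blinfun_apply \<theta> x = of_real r"
    by (simp add: \<theta>_def adjoint_op_def \<psi>_Tx)
  have "norm \<theta> \<le> r"
    using semi_inner_product_norm_le[OF ipX, of _ x] assms(5) r
    by (intro norm_blinfun_bound) (auto simp: \<theta> norm_mult)
  moreover have "norm \<theta> \<ge> r"
    using norm_blinfun[of \<theta> x] r assms(5) by (simp add: \<theta>_x)
  ultimately have norm_\<theta>: "norm \<theta> = r" by simp

  have "norm (blinfun_apply T x /\<^sub>R r) \<le> norm \<psi>"
    using r by (simp add: norm_\<psi> flip: r_def)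
  then obtain ip1 where ip1: "semi_inner_product dual_scale (dual_space sY) ip1"
    "\<And>g. ip1 g \<psi> = blinfun_apply g (blinfun_apply T x /\<^sub>R r)"
    using dual_semi_inner_product_evaluation[OF \<psi>_dual] norm_\<psi> \<psi>_unit
    by (metis norm_zero of_real_1 one_power2 zero_neq_one)
  \<comment> \<open>A point supporting \<open>\<theta>\<close> has norm at most
    \<open>norm \<theta> = r\<close> and value \<open>r\<^sup>2\<close>; since
    \<open>\<theta>\<close> takes the value \<open>r\<close> at the unit vector \<open>x\<close>,
    the point \<open>r *\<^sub>R x\<close> qualifies.\<close>
  have "norm (r *\<^sub>R x) \<le> norm \<theta>" "blinfun_apply \<theta> (r *\<^sub>R x) = of_real ((norm \<theta>)\<^sup>2)" "\<theta> \<noteq> 0"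
    using r assms(5) norm_\<theta>
    by (auto simp: blinfun.scaleR_right \<theta>_x scaleR_conv_of_real power2_eq_square)
  then obtain ip2 where ip2: "semi_inner_product dual_scale (dual_space sX) ip2"
    "\<And>f. ip2 f \<theta> = blinfun_apply f (r *\<^sub>R x)"
    using dual_semi_inner_product_evaluation[OF \<theta>_dual] by metis
  \<comment> \<open>The two points match: \<open>T\<close> maps \<open>r *\<^sub>R x\<close> to
    \<open>r\<^sup>2\<close> times the normalised \<open>T x\<close>, so the level number is again
    \<open>r\<^sup>2\<close>.\<close>
  have "ip2 (adjoint_op T g) (adjoint_op T \<psi>) = k * ip1 g \<psi>" for g
    unfolding \<theta>_def[symmetric] ip2(2) ip1(2) using r
    by (simp add: adjoint_op_def blinfun.scaleR_right k_def scaleR_conv_of_real power2_eq_square)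
  then have lk': "is_level_number dual_scale (dual_space sY) dual_scale (dual_space sX) (adjoint_op T) \<psi> k"
    using ip1(1) ip2(1) unfolding is_level_number_def by blast
  then have lv: "level_vector dual_scale (dual_space sY) dual_scale (dual_space sX) (adjoint_op T) \<psi>"
    using \<psi>_dual norm_\<psi> unfolding level_vector_def by auto
  have "level_number dual_scale (dual_space sY) dual_scale (dual_space sX) (adjoint_op T) \<psi> = k"
    unfolding level_number_def
    \<comment> \<open>Uniqueness requires the image of \<open>\<psi>\<close> to lie in the target
      carrier, which is \<open>\<theta>_dual\<close>.\<close>
    using is_level_number_unique[OF lv] \<theta>_dual lk' by (auto simp: \<theta>_def intro: the1_equality)
  moreover have "level_number sX UNIV sY UNIV (blinfun_apply T) x = k"
    unfolding level_number_def
    using is_level_number_unique[OF assms(7)] lk by (auto intro: the1_equality)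
  ultimately show ?thesis
    using supp lv by auto
qed

end
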